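(* Let $\Gamma\curvearrowright X, I$ be a dynamical ideal with permutation model $W[[X]]$. (1) If $W[[X]]$ fails the axiom of dependent choices, then Player I has a winning strategy in the DC game. (2) If $X$ is a Polish space and $I$ is generated (as an ideal, i.e. $I$ consists of all subsets of sets in the family) by an analytic family of closed subsets of $X$ (analytic in the Effros Borel space / hyperspace of closed sets), then the DC game is determined.
   Context: Work in ZFC. $V[[X]]$ is the well-founded model of ZFCA with set of atoms exactly $X$ in which every set of elements is represented by an element; a group action of $\Gamma$ on $X$ extends to $V[[X]]$ by $\gamma\cdot A=\{\gamma\cdot B:B\in A\}$. $\mathrm{stab}(A)=\{\gamma:\gamma\cdot A=A\}$, $\mathrm{pstab}(a)=\{\gamma:\gamma\cdot B=B\ \forall B\in a\}$. A dynamical ideal $\Gamma\curvearrowright X, I$: a group $\Gamma$ acting on $X$ and a $\Gamma$-invariant ideal $I$ on $X$ containing all singletons. Its permutation model $W[[X]]$ is the class of $A\in V[[X]]$ such that $A$ and every element of its transitive closure are symmetric, where $A$ is symmetric if $\mathrm{pstab}(b)\subseteq\mathrm{stab}(A)$ for some $b\in I$. The axiom of dependent choices (DC): every partial order has either a minimal element or an infinite strictly descending sequence. The DC game: players I and II alternate for $\omega$ rounds; at round $n$ Player I plays $a_n\in I$ and Player II answers with $\gamma_n\in\Gamma$, subject to the rules $\gamma_0=1$ and $\gamma_n$ fixes every element of $\bigcup_{m<n}\gamma_m\cdot a_m$. Player II wins if $\bigcup_{n\in\omega}\gamma_n\cdot a_n\in I$; otherwise Player I wins. The game is determined if one of the players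 has a winning strategy. *)

theory Defs
  imports "HOL-Analysis.Analysis" "HOL-Algebra.Group_Action"
begin

definition dynamical_ideal ::
  "('g, 'b) monoid_scheme \<Rightarrow> ('g \<Rightarrow> 'x \<Rightarrow> 'x) \<Rightarrow> 'x set \<Rightarrow> 'x set set \<Rightarrow> bool" where
  "dynamical_ideal G \<phi> X I \<longleftrightarrow>
     group_action G X \<phi> \<and>
     I \<subseteq> Pow X \<and> {} \<in> I \<and>
     (\<forall>A\<in>I. \<forall>B. B \<subseteq> A \<longrightarrow> B \<in> I) \<and>
     (\<forall>A\<in>I. \<forall>B\<in>I. A \<union> B \<in> I) \<and>
     (\<forall>x\<in>X. {x} \<in> I) \<and>
     (\<forall>g\<in>carrier G. \<forall>A\<in>I. \<phi> g ` A \<in> I)"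

definition pstab :: "('g, 'b) monoid_scheme \<Rightarrow> ('g \<Rightarrow> 'x \<Rightarrow> 'x) \<Rightarrow> 'x set \<Rightarrow> 'g set" where
  "pstab G \<phi> a = {g \<in> carrier G. \<forall>x\<in>a. \<phi> g x = x}"

text \<open>A run of the game: I plays a n, II plays g n. The run obeys the rules iff
  g 0 = 1 and g n fixes every element of the union of g m applied to a m, m < n.\<close>
definition legal_run ::
  "('g, 'b) monoid_scheme \<Rightarrow> ('g \<Rightarrow> 'x \<Rightarrow> 'x) \<Rightarrow> (nat \<Rightarrow> 'x set) \<Rightarrow> (nat \<Rightarrow> 'g) \<Rightarrow> bool" where
  "legal_run G \<phi> a g \<longleftrightarrow>
     (\<forall>n. g n \<in> carrier G) \<and> g 0 = \<one>\<^bsub>G\<^esub> \<and>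
     (\<forall>n. \<forall>x \<in> (\<Union>m<n. \<phi> (g m) ` a m). \<phi> (g n) x = x)"

definition run_union :: "('g \<Rightarrow> 'x \<Rightarrow> 'x) \<Rightarrow> (nat \<Rightarrow> 'x set) \<Rightarrow> (nat \<Rightarrow> 'g) \<Rightarrow> 'x set" where
  "run_union \<phi> a g = (\<Union>n. \<phi> (g n) ` a n)"

text \<open>A strategy for Player I maps the list of II's previous moves to I's next move
  (I's own previous moves are determined by the strategy).\<close>
definition I_wins ::
  "('g, 'b) monoid_scheme \<Rightarrow> ('g \<Rightarrow> 'x \<Rightarrow> 'x) \<Rightarrow> 'x set set \<Rightarrow> bool" where
  "I_wins G \<phi> I \<longleftrightarrow>
     (\<exists>\<sigma> :: 'g list \<Rightarrow> 'x set. (\<forall>h. \<sigma> h \<in> I) \<and>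
        (\<forall>g. legal_run G \<phi> (\<lambda>n. \<sigma> (map g [0..<n])) g \<longrightarrow>
             run_union \<phi> (\<lambda>n. \<sigma> (map g [0..<n])) g \<notin> I))"

definition II_wins ::
  "('g, 'b) monoid_scheme \<Rightarrow> ('g \<Rightarrow> 'x \<Rightarrow> 'x) \<Rightarrow> 'x set set \<Rightarrow> bool" where
  "II_wins G \<phi> I \<longleftrightarrow>
     (\<exists>\<tau> :: 'x set list \<Rightarrow> 'g.
        \<forall>a. (\<forall>n. a n \<in> I) \<longrightarrow>
            legal_run G \<phi> a (\<lambda>n. \<tau> (map a [0..<Suc n])) \<and>
            run_union \<phi> a (\<lambda>n. \<tau> (map a [0..<Suc n])) \<in> I)"

definition DC_game_determined ::
  "('g, 'b) monoid_scheme \<Rightarrow> ('g \<Rightarrow> 'x \<Rightarrow> 'x) \<Rightarrow> 'x set set \<Rightarrow> bool" where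
  "DC_game_determined G \<phi> I \<longleftrightarrow> I_wins G \<phi> I \<or> II_wins G \<phi> I"

text \<open>Since V[[X]] is a proper class, it cannot be a HOL set. Instead, elements of
  V[[X]] are represented in an arbitrary type 'v carrying a well-founded,
  extensional membership relation mem with atoms atom x (x in X), closed under the
  extended action act. Every such structure embeds (Mostowski collapse) into
  V[[X]] compatibly with the action, and every element of V[[X]] (together with
  the Gamma-closure of its transitive closure) lives in such a structure for a large
  enough type 'v.\<close>

definition elts :: "('v \<Rightarrow> 'v \<Rightarrow> bool) \<Rightarrow> 'v \<Rightarrow> 'v set" where
  "elts mem b = {u. mem u b}"

definition atom_structure ::
  "('g, 'b) monoid_scheme \<Rightarrow> ('g \<Rightarrow> 'x \<Rightarrow> 'x) \<Rightarrow> 'x set \<Rightarrow>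
   ('x \<Rightarrow> 'v) \<Rightarrow> ('v \<Rightarrow> 'v \<Rightarrow> bool) \<Rightarrow> ('g \<Rightarrow> 'v \<Rightarrow> 'v) \<Rightarrow> bool" where
  "atom_structure G \<phi> X atom mem act \<longleftrightarrow>
     inj_on atom X \<and>
     (\<forall>x\<in>X. elts mem (atom x) = {}) \<and>
     wf {(u, v). mem u v} \<and>
     (\<forall>b c. b \<notin> atom ` X \<longrightarrow> c \<notin> atom ` X \<longrightarrow> elts mem b = elts mem c \<longrightarrow> b = c) \<and>
     (\<forall>g\<in>carrier G. \<forall>x\<in>X. act g (atom x) = atom (\<phi> g x)) \<and>
     (\<forall>g\<in>carrier G. \<forall>b. b \<notin> atom ` X \<longrightarrow>
        act g b \<notin> atom ` X \<and> elts mem (act g b) = act g ` elts mem b)"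

definition symmetric_elt ::
  "('g, 'b) monoid_scheme \<Rightarrow> ('g \<Rightarrow> 'x \<Rightarrow> 'x) \<Rightarrow> 'x set set \<Rightarrow> ('g \<Rightarrow> 'v \<Rightarrow> 'v) \<Rightarrow> 'v \<Rightarrow> bool" where
  "symmetric_elt G \<phi> I act A \<longleftrightarrow> (\<exists>b\<in>I. \<forall>g\<in>pstab G \<phi> b. act g A = A)"

definition in_W ::
  "('g, 'b) monoid_scheme \<Rightarrow> ('g \<Rightarrow> 'x \<Rightarrow> 'x) \<Rightarrow> 'x set set \<Rightarrow>
   ('v \<Rightarrow> 'v \<Rightarrow> bool) \<Rightarrow> ('g \<Rightarrow> 'v \<Rightarrow> 'v) \<Rightarrow> 'v \<Rightarrow> bool" where
  "in_W G \<phi> I mem act A \<longleftrightarrow>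
     (\<forall>u. (u, A) \<in> {(u, v). mem u v}\<^sup>* \<longrightarrow> symmetric_elt G \<phi> I act u)"

text \<open>W[[X]] contains a counterexample to DC: a nonempty partial order (P, R) in
  W[[X]] with no minimal element and no strictly descending sequence in W[[X]].
  P is an element of W[[X]] (a non-atom p with elts p = P). An order R on P
  (a set of ordered pairs of elements of W[[X]]) belongs to W[[X]] iff it is
  symmetric, i.e. fixed by pstab(b) for some b in I; a sequence s : omega -> P
  (a set of pairs (n, s n), with n pure) belongs to W[[X]] iff pstab(b) fixes
  every s n, for some b in I.\<close>
definition W_contains_DC_counterexample ::
  "('g, 'b) monoid_scheme \<Rightarrow> ('g \<Rightarrow> 'x \<Rightarrow> 'x) \<Rightarrow> 'x set \<Rightarrow> 'x set set \<Rightarrow>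
   ('x \<Rightarrow> 'v) \<Rightarrow> ('v \<Rightarrow> 'v \<Rightarrow> bool) \<Rightarrow> ('g \<Rightarrow> 'v \<Rightarrow> 'v) \<Rightarrow> bool" where
  "W_contains_DC_counterexample G \<phi> X I atom mem act \<longleftrightarrow>
     (\<exists>p R. p \<notin> atom ` X \<and> in_W G \<phi> I mem act p \<and>
        elts mem p \<noteq> {} \<and>
        R \<subseteq> elts mem p \<times> elts mem p \<and>
        refl_on (elts mem p) R \<and> antisym R \<and> trans R \<and>
        (\<exists>b\<in>I. \<forall>g\<in>pstab G \<phi> b. (\<lambda>(u, v). (act g u, act g v)) ` R = R) \<and>
        \<not> (\<exists>m\<in>elts mem p. \<forall>q\<in>elts mem p. (q, m) \<in> R \<longrightarrow> q = m) \<and>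
        \<not> (\<exists>s. (\<forall>n. s n \<in> elts mem p \<and> (s (Suc n), s n) \<in> R \<and> s (Suc n) \<noteq> s n) \<and>
               (\<exists>b\<in>I. \<forall>g\<in>pstab G \<phi> b. \<forall>n. act g (s n) = s n)))"

definition Polish_topology :: "'a topology \<Rightarrow> bool" where
  "Polish_topology T \<longleftrightarrow> separable_space T \<and> completely_metrizable_space T"

definition effros_borel :: "'a topology \<Rightarrow> 'a set measure" where
  "effros_borel T = sigma {F. closedin T F}
      {{F. closedin T F \<and> F \<inter> U \<noteq> {}} | U. openin T U}"

definition analytic_in :: "'a measure \<Rightarrow> 'a set \<Rightarrow> bool" where
  "analytic_in M A \<longleftrightarrow> A \<subseteq> space M \<and>
     (A = {} \<or> (\<exists>f \<in> (borel :: (nat \<Rightarrow> nat) measure) \<rightarrow>\<^sub>M M. range f = A))"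

end

theory Submission
  imports Defs
begin

text \<open>
  (1) Given a counterexample to DC, Player I builds a strictly descending sequence: at round \<open>n\<close>
  he chooses \<open>p\<^sub>n\<close> strictly below \<open>q\<^sub>n\<^sub>-\<^sub>1\<close>, where \<open>q\<^sub>m = \<gamma>\<^sub>m \<cdot> p\<^sub>m\<close>, and plays a support \<open>a\<^sub>n\<close> of
  \<open>p\<^sub>n\<close> that also supports the order. Then \<open>\<gamma>\<^sub>n \<cdot> a\<^sub>n\<close> supports \<open>q\<^sub>n\<close>, so the rules force \<open>\<gamma>\<^sub>n\<close> to fix
  all earlier \<open>q\<^sub>m\<close>, and the \<open>q\<^sub>n\<close> descend. If the union of the \<open>\<gamma>\<^sub>n \<cdot> a\<^sub>n\<close> were in the ideal, it would
  support the whole sequence.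

  (2) In the unfolded game Player II also plays, digit by digit, a code of a closed set of the
  family covering the union. Borel sets of the Baire space are projections of closed sets, so the
  codes can be chosen such that the payoff is closed for II, and the unfolded game is determined.
  A winning strategy of II yields one in the DC game by forgetting the digits. For Player I, who
  does not see the digits, round \<open>n\<close> of the DC game is devoted to the answer of the unfolded strategy
  to the \<open>n\<close>-th finite sequence of digits: the rounds devoted to the initial segments of a fixed
  infinite sequence form a legal run of the unfolded game.
\<close>

section \<open>Failure of dependent choices\<close>

text \<open>\<open>act\<close> is only given by its recursion on elements, so the action law needs
  induction on membership: atoms inherit it from \<open>\<phi>\<close>, other objects by
  extensionality.\<close>

lemma atom_structure_act_mult:
  assumes "group_action G X \<phi>" and S: "atom_structure G \<phi> X atom mem act"
    and g: "g \<in> carrier G" and h: "h \<in> carrier G"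
  shows "act (g \<otimes>\<^bsub>G\<^esub> h) b = act g (act h b)"
proof -
  interpret group_action G X \<phi> by fact
  interpret group G using group_hom group_hom.axioms(1) by auto
  have gh: "g \<otimes>\<^bsub>G\<^esub> h \<in> carrier G" using g h by simp
  have "wf {(u, v). mem u v}" using S by (simp add: atom_structure_def)
  then show ?thesis
  proof (induction b rule: wf_induct_rule)
    case (less b)
    show ?case
    proof (cases "b \<in> atom ` X")
      case True
      then obtain x where x: "x \<in> X" "b = atom x" by blast
      have "\<phi> h x \<in> X" using element_image[OF h x(1)] by simp
      then show ?thesis
        using x S g h gh by (simp add: atom_structure_def composition_rule)
    next
      case False
      have nonatom: "act k c \<notin> atom ` X \<and> elts mem (act k c) = act k ` elts mem c"
        if "k \<in> carrier G" "c \<notin> atom ` X" for k c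
        using S that by (simp add: atom_structure_def)
      have "act (g \<otimes>\<^bsub>G\<^esub> h) ` elts mem b = (\<lambda>u. act g (act h u)) ` elts mem b"
        using less by (intro image_cong) (auto simp: elts_def)
      then have "elts mem (act (g \<otimes>\<^bsub>G\<^esub> h) b) = elts mem (act g (act h b))"
        using nonatom[OF gh False] nonatom[OF g] nonatom[OF h False] by (simp add: image_image)
      then show ?thesis
        using S nonatom[OF gh False] nonatom[OF g] nonatom[OF h False]
        by (simp add: atom_structure_def)
    qed
  qed
qed

lemma atom_structure_act_one:
  assumes "group_action G X \<phi>" and S: "atom_structure G \<phi> X atom mem act"
  shows "act \<one>\<^bsub>G\<^esub> b = b"
proof -
  interpret group_action G X \<phi> by fact
  interpret group G using group_hom group_hom.axioms(1) by auto
  have "wf {(u, v). mem u v}" using S by (simp add: atom_structure_def)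
  then show ?thesis
  proof (induction b rule: wf_induct_rule)
    case (less b)
    show ?case
    proof (cases "b \<in> atom ` X")
      case True
      then obtain x where x: "x \<in> X" "b = atom x" by blast
      have "\<phi> \<one>\<^bsub>G\<^esub> x = x" using id_eq_one x(1) by (metis restrict_apply')
      then show ?thesis using x S by (simp add: atom_structure_def)
    next
      case False
      have "act \<one>\<^bsub>G\<^esub> ` elts mem b = id ` elts mem b"
        using less by (intro image_cong) (auto simp: elts_def)
      moreover have "act \<one>\<^bsub>G\<^esub> b \<notin> atom ` X"
        "elts mem (act \<one>\<^bsub>G\<^esub> b) = act \<one>\<^bsub>G\<^esub> ` elts mem b"
        using S False by (simp_all add: atom_structure_def)
      ultimately show ?thesis using S False by (simp add: atom_structure_def)
    qed
  qed
qed

lemma pstab_conjugate: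
  assumes "group_action G X \<phi>" and g: "g \<in> carrier G" and a: "a \<subseteq> X"
    and k: "k \<in> pstab G \<phi> (\<phi> g ` a)"
  shows "inv\<^bsub>G\<^esub> g \<otimes>\<^bsub>G\<^esub> (k \<otimes>\<^bsub>G\<^esub> g) \<in> pstab G \<phi> a"
proof -
  interpret group_action G X \<phi> by fact
  interpret group G using group_hom group_hom.axioms(1) by auto
  have kG: "k \<in> carrier G" using k by (simp add: pstab_def)
  have "\<phi> (inv\<^bsub>G\<^esub> g \<otimes>\<^bsub>G\<^esub> (k \<otimes>\<^bsub>G\<^esub> g)) x = x" if "x \<in> a" for x
  proof -
    have x: "x \<in> X" using that a by blast
    have "\<phi> g x \<in> X" using element_image[OF g x] by simp
    moreover have "\<phi> k (\<phi> g x) = \<phi> g x" using k that by (simp add: pstab_def)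
    ultimately show ?thesis
      using x g kG orbit_sym_aux[OF g x refl] by (simp add: composition_rule)
  qed
  then show ?thesis using g kG by (simp add: pstab_def)
qed

text \<open>Rewriting \<open>k \<otimes> g\<close> as \<open>g\<close> times the conjugate of
  \<open>k\<close>, which lies in \<open>pstab G \<phi> a\<close>, shows that supports move along
  with the group.\<close>

lemma support_translate:
  assumes A: "group_action G X \<phi>" and S: "atom_structure G \<phi> X atom mem act"
    and g: "g \<in> carrier G" and a: "a \<subseteq> X"
    and fixes_u: "\<And>k. k \<in> pstab G \<phi> a \<Longrightarrow> act k u = u"
    and k: "k \<in> pstab G \<phi> (\<phi> g ` a)"
  shows "act k (act g u) = act g u"
proof -
  interpret group_action G X \<phi> by fact
  interpret group G using group_hom group_hom.axioms(1) by auto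
  have kG: "k \<in> carrier G" using k by (simp add: pstab_def)
  let ?c = "inv\<^bsub>G\<^esub> g \<otimes>\<^bsub>G\<^esub> (k \<otimes>\<^bsub>G\<^esub> g)"
  have "act g u = act g (act ?c u)"
    using fixes_u[OF pstab_conjugate[OF A g a k]] by simp
  also have "\<dots> = act (g \<otimes>\<^bsub>G\<^esub> ?c) u"
    using g kG by (simp add: atom_structure_act_mult[OF A S])
  also have "g \<otimes>\<^bsub>G\<^esub> ?c = k \<otimes>\<^bsub>G\<^esub> g"
    using g kG by (simp add: m_assoc[symmetric])
  also have "act (k \<otimes>\<^bsub>G\<^esub> g) u = act k (act g u)"
    using g kG by (simp add: atom_structure_act_mult[OF A S])
  finally show ?thesis by simp
qed

lemma DC_counterexample_imp_I_wins:
  assumes dyn: "dynamical_ideal G \<phi> X I"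
    and S: "atom_structure G \<phi> X atom mem act"
    and ce: "W_contains_DC_counterexample G \<phi> X I atom mem act"
  shows "I_wins G \<phi> I"
proof -
  have A: "group_action G X \<phi>" and IX: "I \<subseteq> Pow X" and empty: "{} \<in> I"
    and down: "\<And>a b. a \<in> I \<Longrightarrow> b \<subseteq> a \<Longrightarrow> b \<in> I"
    and un: "\<And>a b. a \<in> I \<Longrightarrow> b \<in> I \<Longrightarrow> a \<union> b \<in> I"
    using dyn by (auto simp: dynamical_ideal_def)
  interpret group_action G X \<phi> by fact
  interpret group G using group_hom group_hom.axioms(1) by auto
  obtain p R where p: "p \<notin> atom ` X" "in_W G \<phi> I mem act p" "elts mem p \<noteq> {}"
    and symR: "\<exists>b\<in>I. \<forall>g\<in>pstab G \<phi> b. (\<lambda>(u, v). (act g u, act g v)) ` R = R"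
    and nomin: "\<not> (\<exists>m\<in>elts mem p. \<forall>q\<in>elts mem p. (q, m) \<in> R \<longrightarrow> q = m)"
    and nodesc: "\<not> (\<exists>s. (\<forall>n. s n \<in> elts mem p \<and> (s (Suc n), s n) \<in> R \<and> s (Suc n) \<noteq> s n) \<and>
               (\<exists>b\<in>I. \<forall>g\<in>pstab G \<phi> b. \<forall>n. act g (s n) = s n))"
    using ce unfolding W_contains_DC_counterexample_def by blast
  let ?P = "elts mem p"
  obtain bR where bR: "bR \<in> I"
    "\<And>g. g \<in> pstab G \<phi> bR \<Longrightarrow> (\<lambda>(u, v). (act g u, act g v)) ` R = R"
    using symR by blast
  obtain bp where bp: "bp \<in> I" "\<And>g. g \<in> pstab G \<phi> bp \<Longrightarrow> act g p = p"
    using p(2) by (auto simp: in_W_def symmetric_elt_def)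
  \<comment> \<open>A common support of the order and its underlying set; contained in every move of
    Player I, it makes all answers preserve \<open>R\<close> and \<open>?P\<close>.\<close>
  define b where "b = bR \<union> bp"
  have b: "b \<in> I" using un bR(1) bp(1) by (simp add: b_def)
  have actR: "(act g u, act g v) \<in> R" if "g \<in> pstab G \<phi> b" "(u, v) \<in> R" for g u v
  proof -
    have "g \<in> pstab G \<phi> bR" using that by (auto simp: pstab_def b_def)
    then have "(\<lambda>(u, v). (act g u, act g v)) ` R = R" by (rule bR(2))
    then show ?thesis using that(2) by force
  qed
  have actP: "act g u \<in> ?P" if "g \<in> pstab G \<phi> b" "u \<in> ?P" for g u
  proof -
    have g: "g \<in> carrier G" "act g p = p"
      using that bp(2)[of g] by (auto simp: pstab_def b_def)
    have "elts mem (act g p) = act g ` ?P"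
      using S p(1) g(1) by (simp add: atom_structure_def)
    then show ?thesis using g(2) that(2) by auto
  qed
  have act_inj: "u = v" if "g \<in> carrier G" "act g u = act g v" for g u v
  proof -
    have "act (inv\<^bsub>G\<^esub> g) (act g w) = w" for w
      using that(1) atom_structure_act_mult[OF A S, of "inv\<^bsub>G\<^esub> g" g w]
      by (simp add: atom_structure_act_one[OF A S])
    then show ?thesis using that(2) by metis
  qed
  obtain below where below: "\<And>q. q \<in> ?P \<Longrightarrow> below q \<in> ?P \<and> (below q, q) \<in> R \<and> below q \<noteq> q"
    using nomin by metis
  have "\<exists>a\<in>I. \<forall>g\<in>pstab G \<phi> a. act g q = q" if "q \<in> ?P" for q
    using p(2) that unfolding in_W_def symmetric_elt_def elts_def by blast
  then obtain supp0 where supp0: "\<And>q. q \<in> ?P \<Longrightarrow> supp0 q \<in> I"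
    "\<And>q g. q \<in> ?P \<Longrightarrow> g \<in> pstab G \<phi> (supp0 q) \<Longrightarrow> act g q = q"
    by metis
  \<comment> \<open>\<open>cand h\<close> may leave \<open>?P\<close> when \<open>h\<close> breaks
    the rules; the default \<open>{}\<close> keeps every move in \<open>I\<close>.\<close>
  define supp where "supp q = (if q \<in> ?P then supp0 q else {})" for q
  obtain p0 where p0: "p0 \<in> ?P" using p(3) by blast
  \<comment> \<open>Each answer \<open>g\<close> moves the last chosen element to
    \<open>act g q\<close>; the next one is chosen below that.\<close>
  define cand where "cand = foldl (\<lambda>q g. below (act g q)) p0"
  define \<sigma> where "\<sigma> h = b \<union> supp (cand h)" for h
  have \<sigma>I: "\<sigma> h \<in> I" for h
    using un b supp0(1) empty by (simp add: \<sigma>_def supp_def)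
  have "run_union \<phi> (\<lambda>n. \<sigma> (map g [0..<n])) g \<notin> I"
    if legal: "legal_run G \<phi> (\<lambda>n. \<sigma> (map g [0..<n])) g" for g
  proof
    assume inI: "run_union \<phi> (\<lambda>n. \<sigma> (map g [0..<n])) g \<in> I"
    let ?a = "\<lambda>n. \<sigma> (map g [0..<n])"
    define r where "r n = cand (map g [0..<n])" for n
    have gG: "g n \<in> carrier G" for n using legal by (simp add: legal_run_def)
    have g0: "g 0 = \<one>\<^bsub>G\<^esub>" using legal by (simp add: legal_run_def)
    have gfix: "\<phi> (g n) x = x" if "m < n" "x \<in> \<phi> (g m) ` ?a m" for m n x
      using legal that unfolding legal_run_def by blast
    have one_id: "\<phi> \<one>\<^bsub>G\<^esub> x = x" if "x \<in> X" for x
      using id_eq_one that by (metis restrict_apply')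
    have bX: "b \<subseteq> X" using b IX by blast
    \<comment> \<open>The first answer is the identity, so \<open>b\<close> enters the first set
      untranslated and the rules make all later answers fix it.\<close>
    have b0: "b \<subseteq> \<phi> (g 0) ` ?a 0"
    proof
      fix x assume "x \<in> b"
      then have "\<phi> (g 0) x = x" "x \<in> ?a 0" using bX one_id g0 by (auto simp: \<sigma>_def)
      then show "x \<in> \<phi> (g 0) ` ?a 0" by (metis imageI)
    qed
    have gb: "g n \<in> pstab G \<phi> b" for n
    proof (cases "n = 0")
      case True then show ?thesis using bX one_id g0 by (auto simp: pstab_def)
    next
      case False then show ?thesis using gfix[of 0 n] b0 gG by (auto simp: pstab_def)
    qed
    have r_Suc: "r (Suc n) = below (act (g n) (r n))" for n
      by (simp add: r_def cand_def)
    have rP: "r n \<in> ?P" for n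
    proof (induction n)
      case 0 then show ?case using p0 by (simp add: r_def cand_def)
    next
      case (Suc n) then show ?case using below actP[OF gb] by (simp add: r_Suc)
    qed
    define s where "s n = act (g n) (r n)" for n
    have sP: "s n \<in> ?P" for n using actP[OF gb rP] by (simp add: s_def)
    have sfix: "act k (s n) = s n" if "k \<in> pstab G \<phi> (\<phi> (g n) ` ?a n)" for k n
      unfolding s_def
    proof (rule support_translate[OF A S gG _ _ that])
      show "?a n \<subseteq> X" using \<sigma>I IX by blast
      fix k assume "k \<in> pstab G \<phi> (?a n)"
      then have "k \<in> pstab G \<phi> (supp0 (r n))"
        using rP[of n] by (auto simp: pstab_def \<sigma>_def supp_def r_def)
      then show "act k (r n) = r n" by (rule supp0(2)[OF rP])
    qed
    \<comment> \<open>Apply \<open>g (Suc n)\<close> to \<open>r (Suc n)\<close> and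
      \<open>s n\<close>: it preserves the order and fixes \<open>s n\<close>, whose support it
      fixes pointwise.\<close>
    have step: "(s (Suc n), s n) \<in> R \<and> s (Suc n) \<noteq> s n" for n
    proof -
      have lt: "(r (Suc n), s n) \<in> R" "r (Suc n) \<noteq> s n"
        using below[OF sP] by (simp_all add: r_Suc s_def)
      have "g (Suc n) \<in> pstab G \<phi> (\<phi> (g n) ` ?a n)"
        using gfix[of n "Suc n"] gG by (auto simp: pstab_def)
      then have fix_s: "act (g (Suc n)) (s n) = s n" by (rule sfix)
      have "(s (Suc n), s n) \<in> R"
        using actR[OF gb lt(1)] fix_s by (metis s_def)
      moreover have "s (Suc n) \<noteq> s n"
        using act_inj[OF gG] lt(2) fix_s by (metis s_def)
      ultimately show ?thesis by blast
    qed
    have "act k (s n) = s n" if "k \<in> pstab G \<phi> (run_union \<phi> ?a g)" for k n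
      using that by (intro sfix) (auto simp: pstab_def run_union_def)
    then show False using nodesc sP step inI by blast
  qed
  then show ?thesis using \<sigma>I unfolding I_wins_def by blast
qed

section \<open>Determinacy of open games\<close>

text \<open>Gale-Stewart analysis: the positions from which Player I can force \<open>bad\<close>,
  with derivations in place of ordinal ranks. Replies are unrestricted, so rules on them must be
  part of \<open>bad\<close>.\<close>

inductive forced :: "'a set \<Rightarrow> (('a \<times> 'b) list \<Rightarrow> bool) \<Rightarrow> ('a \<times> 'b) list \<Rightarrow> bool"
  for A bad where
  forced_bad: "bad h \<Longrightarrow> forced A bad h"
| forced_step: "a \<in> A \<Longrightarrow> (\<And>b. forced A bad (h @ [(a, b)])) \<Longrightarrow> forced A bad h"

lemma forced_imp_strategy:
  assumes "forced A bad h" and "A \<noteq> {}"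
  shows "\<exists>\<sigma>. (\<forall>u. \<sigma> u \<in> A) \<and>
    (\<forall>b. \<exists>n. bad (h @ map (\<lambda>i. (\<sigma> (map b [0..<i]), b i)) [0..<n]))"
  using assms(1)
proof induction
  case (forced_bad h)
  obtain a where "a \<in> A" using assms(2) by blast
  have "bad (h @ map (\<lambda>i. (a, b i)) [0..<0])" for b
    using forced_bad by simp
  then show ?case using \<open>a \<in> A\<close> by (intro exI[of _ "\<lambda>_. a"]) blast
next
  case (forced_step a h)
  then obtain S where SA: "\<And>c u. S c u \<in> A"
    and S: "\<And>c b. \<exists>n. bad ((h @ [(a, c)]) @ map (\<lambda>i. (S c (map b [0..<i]), b i)) [0..<n])"
    by metis
  \<comment> \<open>The first reply \<open>c\<close> selects the strategy \<open>S c\<close>, given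
    by induction, which sees only the later replies.\<close>
  define \<sigma> where "\<sigma> u = (case u of [] \<Rightarrow> a | c # cs \<Rightarrow> S c cs)" for u
  have "\<exists>n. bad (h @ map (\<lambda>i. (\<sigma> (map b [0..<i]), b i)) [0..<n])" for b
  proof -
    obtain n where n: "bad ((h @ [(a, b 0)]) @
        map (\<lambda>i. (S (b 0) (map (\<lambda>j. b (Suc j)) [0..<i]), b (Suc i))) [0..<n])"
      using S[of "b 0" "\<lambda>j. b (Suc j)"] by blast
    have "map (\<lambda>i. (\<sigma> (map b [0..<i]), b i)) [0..<Suc n] =
      (a, b 0) # map (\<lambda>i. (S (b 0) (map (\<lambda>j. b (Suc j)) [0..<i]), b (Suc i))) [0..<n]"
      unfolding map_upt_Suc by (simp add: \<sigma>_def map_upt_Suc del: upt_Suc)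
    then show ?thesis using n by (intro exI[of _ "Suc n"]) simp
  qed
  moreover have "\<sigma> u \<in> A" for u
    using SA forced_step(1) by (simp add: \<sigma>_def split: list.split)
  ultimately show ?case by blast
qed

text \<open>Outside \<open>forced\<close>, every move in \<open>A\<close> has a reply that stays
  outside; choosing such replies avoids \<open>bad\<close> forever.\<close>

lemma not_forced_imp_strategy:
  assumes "\<not> forced A bad []"
  shows "\<exists>\<tau>. \<forall>a. (\<forall>n. a n \<in> A) \<longrightarrow>
    (\<forall>n. \<not> bad (map (\<lambda>i. (a i, \<tau> (map a [0..<Suc i]))) [0..<n]))"
proof -
  have "\<exists>b. \<not> forced A bad (h @ [(a, b)])" if "\<not> forced A bad h" "a \<in> A" for h a
    using that forced_step by metis
  then obtain N where N: "\<And>h a. \<not> forced A bad h \<Longrightarrow> a \<in> A \<Longrightarrow> \<not> forced A bad (h @ [(a, N h a)])"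
    by metis
  \<comment> \<open>The strategy receives only Player I's moves, so the position is rebuilt from
    them and the reply read off its last round.\<close>
  define pos where "pos = foldl (\<lambda>h a. h @ [(a, N h a)]) []"
  define \<tau> where "\<tau> u = snd (last (pos u))" for u
  have "\<not> bad (map (\<lambda>i. (a i, \<tau> (map a [0..<Suc i]))) [0..<n])" if a: "\<forall>n. a n \<in> A" for a n
  proof -
    have "map (\<lambda>i. (a i, \<tau> (map a [0..<Suc i]))) [0..<n] = pos (map a [0..<n]) \<and>
      \<not> forced A bad (pos (map a [0..<n]))"
    proof (induction n)
      case 0
      then show ?case using assms by (simp add: pos_def)
    next
      case (Suc n)
      have "pos (map a [0..<Suc n]) =
          pos (map a [0..<n]) @ [(a n, N (pos (map a [0..<n])) (a n))]"
        by (simp add: pos_def)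
      then show ?case using Suc N a by (simp add: \<tau>_def)
    qed
    then show ?thesis using forced_bad by metis
  qed
  then show ?thesis by blast
qed

section \<open>Borel sets of the Baire space as projections of closed sets\<close>

definition souslin :: "(nat \<Rightarrow> nat) set \<Rightarrow> bool" where
  "souslin S \<longleftrightarrow> (\<exists>C :: ((nat \<Rightarrow> nat) \<times> (nat \<Rightarrow> nat)) set. closed C \<and> S = fst ` C)"

lemma closed_nat_set: "closed (A :: nat set)"
  by (simp add: closed_def open_discrete)

lemma baire_open_cylinder:
  fixes U :: "(nat \<Rightarrow> nat) set"
  assumes "open U" and "x \<in> U"
  shows "\<exists>n. \<forall>y. (\<forall>i<n. y i = x i) \<longrightarrow> y \<in> U"
proof -
  have "openin (product_topology (\<lambda>i. euclidean) UNIV) U"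
    using assms(1) by (simp add: open_fun_def)
  from product_topology_open_contains_basis[OF this assms(2)]
  obtain Y where Y: "x \<in> (\<Pi>\<^sub>E i\<in>UNIV. Y i)" "finite {i. Y i \<noteq> (UNIV :: nat set)}"
    "(\<Pi>\<^sub>E i\<in>UNIV. Y i) \<subseteq> U"
    by auto
  obtain n where n: "{i. Y i \<noteq> UNIV} \<subseteq> {..<n}"
    using finite_nat_iff_bounded Y(2) by blast
  have "y \<in> U" if y: "\<forall>i<n. y i = x i" for y
  proof -
    have "y i \<in> Y i" for i
      using y n Y(1) by (cases "i < n") (auto simp: PiE_iff)
    then show ?thesis using Y(3) by auto
  qed
  then show ?thesis by blast
qed

lemma baire_cylinder_open: "open {y :: nat \<Rightarrow> nat. \<forall>i<n. y i = x i}"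
  using product_topology_basis'[of "{..<n}" "\<lambda>i. {x i}" id] by (simp add: open_discrete Ball_def)

lemma souslin_closed: "closed S \<Longrightarrow> souslin S"
  unfolding souslin_def by (intro exI[of _ "S \<times> UNIV"]) (simp add: closed_Times)

text \<open>Digit 0 of the witness names the index \<open>n\<close>; the remaining digits witness
  membership in \<open>S n\<close>.\<close>

lemma souslin_UN:
  assumes "\<And>n :: nat. souslin (S n)"
  shows "souslin (\<Union>n. S n)"
proof -
  obtain C :: "nat \<Rightarrow> ((nat \<Rightarrow> nat) \<times> (nat \<Rightarrow> nat)) set"
    where C: "\<And>n. closed (C n)" "\<And>n. S n = fst ` C n"
    using assms unfolding souslin_def by metis
  \<comment> \<open>An intersection of implications, because a countable union of closed sets need
    not be closed.\<close>
  define D where "D = (\<Inter>n. (\<lambda>p. snd p 0) -` (- {n}) \<union> (\<lambda>p. (fst p, \<lambda>i. snd p (Suc i))) -` C n)"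
  have coord: "continuous_on UNIV (\<lambda>p :: (nat \<Rightarrow> nat) \<times> (nat \<Rightarrow> nat). snd p j)" for j
    by (rule continuous_on_product_then_coordinatewise) (intro continuous_intros)
  have "closed D"
    unfolding D_def
    by (intro closed_INT ballI closed_Un closed_vimage C closed_nat_set coord
        continuous_on_Pair continuous_on_coordinatewise_then_product continuous_on_fst
        continuous_on_id)
  moreover have "(\<Union>n. S n) = fst ` D"
  proof (intro equalityI subsetI)
    fix z assume "z \<in> (\<Union>n. S n)"
    then obtain n w where "(z, w) \<in> C n" using C(2) by auto
    then have "(z, case_nat n w) \<in> D" by (auto simp: D_def)
    then show "z \<in> fst ` D" by (metis fst_conv imageI)
  next
    fix z assume "z \<in> fst ` D"
    then obtain w where "(z, w) \<in> D" by auto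
    then have "(z, \<lambda>i. w (Suc i)) \<in> C (w 0)" by (auto simp: D_def)
    then show "z \<in> (\<Union>n. S n)" using C(2) by (metis UN_I UNIV_I fst_conv imageI)
  qed
  ultimately show ?thesis unfolding souslin_def by blast
qed

text \<open>The pairing function merges witnesses for all \<open>S n\<close> into one.\<close>

lemma souslin_INT:
  assumes "\<And>n :: nat. souslin (S n)"
  shows "souslin (\<Inter>n. S n)"
proof -
  obtain C :: "nat \<Rightarrow> ((nat \<Rightarrow> nat) \<times> (nat \<Rightarrow> nat)) set"
    where C: "\<And>n. closed (C n)" "\<And>n. S n = fst ` C n"
    using assms unfolding souslin_def by metis
  define D where "D = (\<Inter>n. (\<lambda>p. (fst p, \<lambda>i. snd p (prod_encode (n, i)))) -` C n)"
  have coord: "continuous_on UNIV (\<lambda>p :: (nat \<Rightarrow> nat) \<times> (nat \<Rightarrow> nat). snd p j)" for j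
    by (rule continuous_on_product_then_coordinatewise) (intro continuous_intros)
  have "closed D"
    unfolding D_def
    by (intro closed_INT ballI closed_vimage C coord
        continuous_on_Pair continuous_on_coordinatewise_then_product continuous_on_fst
        continuous_on_id)
  moreover have "(\<Inter>n. S n) = fst ` D"
  proof (intro equalityI subsetI)
    fix z assume "z \<in> (\<Inter>n. S n)"
    then have "\<forall>n. \<exists>w. (z, w) \<in> C n" using C(2) by fastforce
    then obtain w where w: "\<And>n. (z, w n) \<in> C n" by metis
    have "(z, \<lambda>m. case prod_decode m of (n, i) \<Rightarrow> w n i) \<in> D"
      using w by (simp add: D_def)
    then show "z \<in> fst ` D" by (metis fst_conv imageI)
  next
    fix z assume "z \<in> fst ` D"
    then obtain w where "(z, w) \<in> D" by auto
    then have "(z, \<lambda>i. w (prod_encode (n, i))) \<in> C n" for n by (auto simp: D_def)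
    then show "z \<in> (\<Inter>n. S n)" using C(2) by (metis INT_I fst_conv imageI)
  qed
  ultimately show ?thesis unfolding souslin_def by blast
qed

lemma souslin_open:
  assumes "open U"
  shows "souslin U"
proof -
  \<comment> \<open>The points whose first \<open>n\<close> coordinates already force membership in
    \<open>U\<close>; as only these coordinates matter, the complement is a union of
    cylinders.\<close>
  define K where "K n = {x. \<forall>y. (\<forall>i<n. y i = x i) \<longrightarrow> y \<in> U}" for n
  have "closed (K n)" for n
    unfolding closed_def
  proof (subst open_subopen, intro ballI)
    fix x assume x: "x \<in> - K n"
    have "{y. \<forall>i<n. y i = x i} \<subseteq> - K n"
      using x by (auto simp: K_def)
    then show "\<exists>V. open V \<and> x \<in> V \<and> V \<subseteq> - K n"
      using baire_cylinder_open[of n x] by blast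
  qed
  moreover have "U = (\<Union>n. K n)"
    using baire_open_cylinder[OF assms] by (auto simp: K_def)
  ultimately show ?thesis using souslin_UN souslin_closed by metis
qed

text \<open>Projections of closed sets are not closed under complement, so the induction carries
  \<open>B\<close> and \<open>- B\<close> together; unions on one side are intersections on the
  other.\<close>

lemma souslin_borel:
  assumes "B \<in> sets (borel :: (nat \<Rightarrow> nat) measure)"
  shows "souslin B \<and> souslin (- B)"
proof -
  have "B \<in> sigma_sets UNIV {S. open S}" using assms by (simp add: sets_borel)
  then show ?thesis
  proof induction
    case (Basic a)
    then show ?case using souslin_open souslin_closed by (simp add: closed_Compl)
  next
    case Empty
    then show ?case using souslin_closed[of "{}"] souslin_closed[of UNIV] by simp
  next
    case (Compl a)
    then show ?case by (simp add: Compl_eq_Diff_UNIV[symmetric])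
  next
    case (Union a)
    then show ?case using souslin_UN[of a] souslin_INT[of "\<lambda>n. - a n"] by simp
  qed
qed

text \<open>Each point of \<open>D\<close> codes some \<open>z\<close> together with the answers to all the questions
  \<open>z \<in> B k\<close> and witnesses, in closed sets, that these answers are correct. The answers thus become
  continuous functions of the code.\<close>

lemma borel_sequence_closed_code:
  fixes B :: "nat \<Rightarrow> (nat \<Rightarrow> nat) set"
  assumes "\<And>k. B k \<in> sets borel"
  obtains D :: "(nat \<Rightarrow> nat) set" and e :: "nat \<Rightarrow> nat" where "closed D"
    and "\<And>z. \<exists>y\<in>D. \<forall>k. y (e k) \<noteq> 0 \<longleftrightarrow> z \<in> B k"
    and "\<And>y. y \<in> D \<Longrightarrow> \<exists>z. \<forall>k. y (e k) \<noteq> 0 \<longleftrightarrow> z \<in> B k"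
proof -
  have "\<exists>C :: ((nat \<Rightarrow> nat) \<times> (nat \<Rightarrow> nat)) set. closed C \<and> B k = fst ` C"
    "\<exists>C :: ((nat \<Rightarrow> nat) \<times> (nat \<Rightarrow> nat)) set. closed C \<and> - B k = fst ` C" for k
    using souslin_borel[OF assms, of k] unfolding souslin_def by simp_all
  then obtain P N :: "nat \<Rightarrow> ((nat \<Rightarrow> nat) \<times> (nat \<Rightarrow> nat)) set"
    where P: "\<And>k. closed (P k)" "\<And>k. B k = fst ` P k"
      and N: "\<And>k. closed (N k)" "\<And>k. - B k = fst ` N k"
    by metis
  \<comment> \<open>A code is an array: row 0 holds the answers, row 1 the point \<open>z\<close>,
    and row \<open>k + 2\<close> the witness for the answer to question \<open>k\<close>.\<close>
  define e where "e k = prod_encode (0, k)" for k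
  define dec :: "nat \<Rightarrow> (nat \<Rightarrow> nat) \<Rightarrow> (nat \<Rightarrow> nat) \<times> (nat \<Rightarrow> nat)" where
    "dec k y = (\<lambda>j. y (prod_encode (1, j)), \<lambda>j. y (prod_encode (k + 2, j)))" for k y
  define D where "D = (\<Inter>k. ((\<lambda>y. y (e k)) -` (- {0}) \<inter> dec k -` P k) \<union>
    ((\<lambda>y. y (e k)) -` {0} \<inter> dec k -` N k))"
  have "continuous_on UNIV (dec k)" for k
    unfolding dec_def
    by (intro continuous_on_Pair continuous_on_coordinatewise_then_product
        continuous_on_product_coordinates)
  then have "closed D"
    unfolding D_def
    by (intro closed_INT ballI closed_Un closed_Int closed_vimage closed_nat_set P N
        continuous_on_product_coordinates)
  moreover have "\<exists>y\<in>D. \<forall>k. y (e k) \<noteq> 0 \<longleftrightarrow> z \<in> B k" for z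
  proof -
    have "\<exists>w. if z \<in> B k then (z, w) \<in> P k else (z, w) \<in> N k" for k
    proof (cases "z \<in> B k")
      case True
      then show ?thesis using P(2) by fastforce
    next
      case False
      then have "z \<in> fst ` N k" using N(2) by blast
      then show ?thesis using False by auto
    qed
    then obtain w where w: "\<And>k. if z \<in> B k then (z, w k) \<in> P k else (z, w k) \<in> N k"
      by metis
    define y where "y m = (case prod_decode m of (r, j) \<Rightarrow>
      if r = 0 then of_bool (z \<in> B j) else if r = 1 then z j else w (r - 2) j)" for m
    have y: "dec k y = (z, w k)" "y (e k) = of_bool (z \<in> B k)" for k
      by (simp_all add: dec_def y_def e_def)
    have "(y (e k) \<noteq> 0 \<and> dec k y \<in> P k) \<or> (y (e k) = 0 \<and> dec k y \<in> N k)" for k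
      using w[of k] y[of k] by (simp split: if_splits)
    then have "y \<in> D" by (simp add: D_def)
    then show ?thesis using y(2) by (intro bexI[of _ y]) auto
  qed
  moreover have "\<exists>z. \<forall>k. y (e k) \<noteq> 0 \<longleftrightarrow> z \<in> B k" if "y \<in> D" for y
  proof (intro exI allI)
    fix k
    have "fst (dec k y) = (\<lambda>j. y (prod_encode (1, j)))" by (simp add: dec_def)
    moreover have "(y (e k) \<noteq> 0 \<and> dec k y \<in> P k) \<or> (y (e k) = 0 \<and> dec k y \<in> N k)"
      using that by (auto simp: D_def)
    moreover have "dec k y \<in> P k \<Longrightarrow> fst (dec k y) \<in> B k"
      "dec k y \<in> N k \<Longrightarrow> fst (dec k y) \<notin> B k" using P(2) N(2) by blast+
    ultimately show "y (e k) \<noteq> 0 \<longleftrightarrow> (\<lambda>j. y (prod_encode (1, j))) \<in> B k" by metis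
  qed
  ultimately show ?thesis using that by blast
qed

section \<open>The unfolded game\<close>

lemma separable_metrizable_base_sequence:
  assumes "separable_space T" and "metrizable_space T"
  obtains Q :: "nat \<Rightarrow> 'a set" where "\<And>k. openin T (Q k)"
    and "\<And>U x. openin T U \<Longrightarrow> x \<in> U \<Longrightarrow> \<exists>k. x \<in> Q k \<and> Q k \<subseteq> U"
proof -
  obtain M d where "Metric_space M d" and T: "T = Metric_space.mtopology M d"
    using assms(2) by (auto simp: metrizable_space_def)
  interpret Metric_space M d by fact
  obtain C where C: "countable C" "C \<subseteq> M" "mtopology closure_of C = M"
    using assms(1) by (auto simp: separable_space_def T)
  \<comment> \<open>Small balls around a countable dense set; \<open>{}\<close> makes the family
    nonempty even over an empty space, so that it can be enumerated.\<close>
  define \<B> where "\<B> = insert {} ((\<lambda>(c, n :: nat). mball c (inverse (real (Suc n)))) ` (C \<times> UNIV))"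
  have cnt: "countable \<B>" "\<B> \<noteq> {}" using C(1) by (simp_all add: \<B>_def)
  have op: "openin T V" if "V \<in> \<B>" for V
    using that by (auto simp: \<B>_def T)
  have base: "\<exists>V\<in>\<B>. x \<in> V \<and> V \<subseteq> U" if U: "openin T U" "x \<in> U" for U x
  proof -
    obtain r where r: "r > 0" "mball x r \<subseteq> U" and x: "x \<in> M"
      using U unfolding T openin_mtopology by blast
    obtain n where n: "inverse (real (Suc n)) < r / 2"
      using reals_Archimedean[of "r / 2"] r(1) by auto
    let ?s = "inverse (real (Suc n))"
    have s: "?s > 0" by simp
    have "x \<in> mtopology closure_of C" using x C(3) by simp
    then obtain c where c: "c \<in> C" "c \<in> mball x ?s"
      using s unfolding metric_closure_of by blast
    have "x \<in> mball c ?s" using c by (simp add: commute in_mball)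
    moreover have "mball c ?s \<subseteq> mball x r"
    proof
      fix v assume v: "v \<in> mball c ?s"
      have "d x v \<le> d x c + d c v" using c v by (intro triangle) (auto simp: in_mball)
      then show "v \<in> mball x r" using c v n by (auto simp: in_mball)
    qed
    moreover have "mball c ?s \<in> \<B>" using c(1) unfolding \<B>_def by auto
    ultimately show ?thesis using r(2) by blast
  qed
  have "range (from_nat_into \<B>) = \<B>" using cnt by (rule range_from_nat_into[rotated])
  then have "openin T (from_nat_into \<B> k)"
    "openin T U \<Longrightarrow> x \<in> U \<Longrightarrow> \<exists>k. x \<in> from_nat_into \<B> k \<and> from_nat_into \<B> k \<subseteq> U" for k U x
    using op base by (blast, metis (full_types) imageE)
  then show ?thesis using that by blast
qed

text \<open>A point of \<open>A\<close> outside \<open>F\<close> has a basic neighbourhood missing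
  \<open>F\<close>. Containment thus depends only on which \<open>Q k\<close> the closed set meets,
  which is Effros Borel information.\<close>

lemma closedin_subset_iff_base:
  assumes "closedin T F" and "A \<subseteq> topspace T"
    and "\<And>U x. openin T U \<Longrightarrow> x \<in> U \<Longrightarrow> \<exists>k. x \<in> Q k \<and> Q k \<subseteq> U"
  shows "A \<subseteq> F \<longleftrightarrow> (\<forall>k. A \<inter> Q k \<noteq> {} \<longrightarrow> F \<inter> Q k \<noteq> {})"
proof
  assume hits: "\<forall>k. A \<inter> Q k \<noteq> {} \<longrightarrow> F \<inter> Q k \<noteq> {}"
  show "A \<subseteq> F"
  proof (rule ccontr)
    assume "\<not> A \<subseteq> F"
    then obtain x where x: "x \<in> A" "x \<in> topspace T - F" using assms(2) by blast
    have "openin T (topspace T - F)" using assms(1) by blast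
    then obtain k where "x \<in> Q k" "Q k \<subseteq> topspace T - F" using assms(3) x(2) by blast
    then show False using hits x(1) by blast
  qed
qed blast

text \<open>Player II's losses all show at a finite stage, so the game is open for Player I. Digit
  \<open>e k\<close> says whether the coded closed set meets \<open>Q k\<close>;
  \<open>e k < n\<close> waits until it has been played.\<close>

definition unfolded_lost ::
  "('g, 'b) monoid_scheme \<Rightarrow> ('g \<Rightarrow> 'x \<Rightarrow> 'x) \<Rightarrow> (nat \<Rightarrow> 'x set) \<Rightarrow> (nat \<Rightarrow> nat) set \<Rightarrow> (nat \<Rightarrow> nat) \<Rightarrow>
    ('x set \<times> 'g \<times> nat) list \<Rightarrow> bool" where
  "unfolded_lost G \<phi> Q D e h \<longleftrightarrow>
     (let n = length h; a = \<lambda>i. fst (h ! i); g = \<lambda>i. fst (snd (h ! i)); y = \<lambda>i. snd (snd (h ! i)) in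
      (\<exists>m<n. g m \<notin> carrier G) \<or> (0 < n \<and> g 0 \<noteq> \<one>\<^bsub>G\<^esub>) \<or>
      (\<exists>m<n. \<exists>l<m. \<exists>x\<in>\<phi> (g l) ` a l. \<phi> (g m) x \<noteq> x) \<or>
      (\<forall>z\<in>D. \<exists>i<n. z i \<noteq> y i) \<or>
      (\<exists>m<n. \<exists>k. e k < n \<and> \<phi> (g m) ` a m \<inter> Q k \<noteq> {} \<and> y (e k) = 0))"

text \<open>Closedness of \<open>D\<close> is the point: if every initial segment of
  \<open>y\<close> extends to a point of \<open>D\<close>, then \<open>y\<close> lies in
  \<open>D\<close>.\<close>

lemma unfolded_lost_run_iff:
  assumes "closed D"
  shows "(\<forall>n. \<not> unfolded_lost G \<phi> Q D e (map (\<lambda>i. (a i, g i, y i)) [0..<n])) \<longleftrightarrow>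
    legal_run G \<phi> a g \<and> y \<in> D \<and> (\<forall>m k. \<phi> (g m) ` a m \<inter> Q k \<noteq> {} \<longrightarrow> y (e k) \<noteq> 0)"
    (is "?L \<longleftrightarrow> ?R")
proof -
  have alive_iff: "\<not> unfolded_lost G \<phi> Q D e (map (\<lambda>i. (a i, g i, y i)) [0..<n]) \<longleftrightarrow>
      (\<forall>m<n. g m \<in> carrier G) \<and> (0 < n \<longrightarrow> g 0 = \<one>\<^bsub>G\<^esub>) \<and>
      (\<forall>m<n. \<forall>l<m. \<forall>x\<in>\<phi> (g l) ` a l. \<phi> (g m) x = x) \<and>
      (\<exists>z\<in>D. \<forall>i<n. z i = y i) \<and>
      (\<forall>m<n. \<forall>k. e k < n \<longrightarrow> \<phi> (g m) ` a m \<inter> Q k \<noteq> {} \<longrightarrow> y (e k) \<noteq> 0)" for n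
    unfolding unfolded_lost_def Let_def
    by (cases "n = 0") (auto simp: disjoint_iff simp del: upt_Suc, (metis less_irrefl)+)
  show ?thesis
  proof
    assume ?R
    then show ?L unfolding alive_iff legal_run_def by blast
  next
    assume L: ?L
    note alive = iffD1[OF alive_iff L[rule_format]]
    note alive_fix = alive[THEN conjunct2, THEN conjunct2, THEN conjunct1, rule_format]
    note alive_code = alive[THEN conjunct2, THEN conjunct2, THEN conjunct2, THEN conjunct1]
    note alive_hit =
      alive[THEN conjunct2, THEN conjunct2, THEN conjunct2, THEN conjunct2, rule_format]
    have "legal_run G \<phi> a g"
      unfolding legal_run_def
    proof (intro conjI allI ballI)
      show "g n \<in> carrier G" for n using alive[of "Suc n"] by (simp only: lessI)
      show "g 0 = \<one>\<^bsub>G\<^esub>" using alive[of 1] by (simp only: zero_less_one)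
      fix n x assume "x \<in> (\<Union>m<n. \<phi> (g m) ` a m)"
      then obtain m where m: "m < n" "x \<in> \<phi> (g m) ` a m" by auto
      show "\<phi> (g n) x = x" by (rule alive_fix[OF lessI m])
    qed
    moreover have "y \<in> D"
    proof (rule ccontr)
      assume "y \<notin> D"
      moreover have "open (- D)" using assms by (simp add: open_Compl)
      ultimately obtain n where "\<forall>z. (\<forall>i<n. z i = y i) \<longrightarrow> z \<in> - D"
        using baire_open_cylinder[of "- D" y] by blast
      then show False using alive_code[of n] by blast
    qed
    moreover have "y (e k) \<noteq> 0" if "\<phi> (g m) ` a m \<inter> Q k \<noteq> {}" for m k
      \<comment> \<open>At this length both move \<open>m\<close> and digit \<open>e k\<close> have
        been played.\<close>
      by (rule alive_hit[of m "Suc (max m (e k))" k]) (use that in auto)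
    ultimately show ?R by blast
  qed
qed

text \<open>The simulated opponent's moves along a reversed list of digits: the group element paired with
  a digit is the one played in the real round whose number codes the preceding digits.\<close>

fun simulated_moves :: "'g list \<Rightarrow> nat list \<Rightarrow> ('g \<times> nat) list" where
  "simulated_moves h [] = []"
| "simulated_moves h (d # ds) = simulated_moves h ds @ [(h ! list_encode ds, d)]"

text \<open>The real round devoted to the first \<open>j\<close> digits of \<open>y\<close>; the
  reversal turns appending a digit into a Cons, as in \<open>simulated_moves\<close>.\<close>

definition round_code :: "(nat \<Rightarrow> nat) \<Rightarrow> nat \<Rightarrow> nat" where
  "round_code y j = list_encode (rev (map y [0..<j]))"

text \<open>The code of a Cons is the successor of a pair code bounding the code of the tail, so
  longer segments are treated in later rounds.\<close>

lemma round_code_strict_mono: "strict_mono (round_code y)"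
  unfolding strict_mono_Suc_iff
  by (simp add: round_code_def less_Suc_eq_le le_prod_encode_2)

text \<open>The bound ensures that all rounds looked up, those of proper initial segments, precede
  round \<open>N\<close>.\<close>

lemma simulated_moves_run:
  assumes "round_code y j \<le> N"
  shows "simulated_moves (map g [0..<N]) (rev (map y [0..<j])) =
    map (\<lambda>i. (g (round_code y i), y i)) [0..<j]"
  using assms
proof (induction j)
  case (Suc j)
  then have "round_code y j < N"
    using strict_monoD[OF round_code_strict_mono, of j "Suc j" y] by linarith
  then show ?case using Suc.IH by (simp add: round_code_def)
qed simp

text \<open>The digits are chosen only after the run: a union in \<open>I\<close> would have a cover
  coded by some \<open>y\<close>, and the rounds \<open>round_code y j\<close> would be a run
  defeating \<open>\<sigma>\<close>.\<close>

lemma unfolded_I_strategy_imp_I_wins: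
  fixes \<sigma> :: "('g \<times> nat) list \<Rightarrow> 'x set"
  assumes \<sigma>I: "\<And>u. \<sigma> u \<in> I"
    and win: "\<And>g y. legal_run G \<phi> (\<lambda>n. \<sigma> (map (\<lambda>i. (g i, y i)) [0..<n])) g \<Longrightarrow>
      \<not> (run_union \<phi> (\<lambda>n. \<sigma> (map (\<lambda>i. (g i, y i)) [0..<n])) g \<subseteq> F y \<and> y \<in> D)"
    and cover: "\<And>A. A \<in> I \<Longrightarrow> \<exists>y\<in>D. A \<subseteq> F y"
  shows "I_wins G \<phi> I"
proof -
  \<comment> \<open>The length of the history is the round number; decoding it gives the reversed
    digits treated in this round.\<close>
  define \<rho> where "\<rho> h = \<sigma> (simulated_moves h (list_decode (length h)))" for h
  have "run_union \<phi> (\<lambda>n. \<rho> (map g [0..<n])) g \<notin> I"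
    if legal: "legal_run G \<phi> (\<lambda>n. \<rho> (map g [0..<n])) g" for g
  proof
    assume "run_union \<phi> (\<lambda>n. \<rho> (map g [0..<n])) g \<in> I"
    then obtain y where y: "y \<in> D" "run_union \<phi> (\<lambda>n. \<rho> (map g [0..<n])) g \<subseteq> F y"
      using cover by blast
    let ?c = "round_code y"
    let ?a = "\<lambda>j. \<sigma> (map (\<lambda>i. (g (?c i), y i)) [0..<j])"
    have a: "?a j = \<rho> (map g [0..<?c j])" for j
      using simulated_moves_run[of y j "?c j" g] by (simp add: \<rho>_def) (simp add: round_code_def)
    have "legal_run G \<phi> ?a (\<lambda>j. g (?c j))"
      unfolding legal_run_def
    proof (intro conjI allI ballI)
      show "g (?c n) \<in> carrier G" for n using legal by (simp add: legal_run_def)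
      \<comment> \<open>The empty list has code 0, so the simulated run starts with the real opening
        round.\<close>
      show "g (?c 0) = \<one>\<^bsub>G\<^esub>" using legal by (simp add: legal_run_def round_code_def)
      fix n x assume "x \<in> (\<Union>m<n. \<phi> (g (?c m)) ` ?a m)"
      then obtain m where "m < n" "x \<in> \<phi> (g (?c m)) ` \<rho> (map g [0..<?c m])"
        unfolding a by blast
      moreover from this have "?c m < ?c n" using round_code_strict_mono strict_monoD by blast
      ultimately show "\<phi> (g (?c n)) x = x" using legal unfolding legal_run_def by blast
    qed
    moreover have "run_union \<phi> ?a (\<lambda>j. g (?c j)) \<subseteq> F y"
      using y(2) unfolding run_union_def a by blast
    ultimately show False using win[of "\<lambda>j. g (?c j)" y] y(1) by blast
  qed
  moreover have "\<rho> h \<in> I" for h using \<sigma>I by (simp add: \<rho>_def)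
  ultimately show ?thesis unfolding I_wins_def by blast
qed

section \<open>Determinacy for analytically generated ideals\<close>

lemma analytic_closed_generated_determined:
  fixes T :: "'x topology"
  assumes dyn: "dynamical_ideal G \<phi> X I"
    and "Polish_topology T" and topX: "topspace T = X"
    and closed\<F>: "\<F> \<subseteq> {F. closedin T F}" and an: "analytic_in (effros_borel T) \<F>"
    and I: "I = {A. \<exists>B\<in>\<F>. A \<subseteq> B}"
  shows "DC_game_determined G \<phi> I"
proof -
  have IX: "I \<subseteq> Pow X" and empty: "{} \<in> I"
    and inv: "\<And>g A. g \<in> carrier G \<Longrightarrow> A \<in> I \<Longrightarrow> \<phi> g ` A \<in> I"
    using dyn by (auto simp: dynamical_ideal_def)
  have "\<F> \<noteq> {}" using empty I by auto
  then obtain f where f: "f \<in> (borel :: (nat \<Rightarrow> nat) measure) \<rightarrow>\<^sub>M effros_borel T" "range f = \<F>"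
    using an unfolding analytic_in_def by blast
  have sep: "separable_space T" and met: "metrizable_space T"
    using assms(2) completely_metrizable_imp_metrizable_space by (auto simp: Polish_topology_def)
  obtain Q :: "nat \<Rightarrow> 'x set" where Q: "\<And>k. openin T (Q k)"
    and base: "\<And>U x. openin T U \<Longrightarrow> x \<in> U \<Longrightarrow> \<exists>k. x \<in> Q k \<and> Q k \<subseteq> U"
    using separable_metrizable_base_sequence[OF sep met] by blast
  have cl: "closedin T (f z)" for z
    using subsetD[OF closed\<F>, of "f z"] f(2) by auto
  have meas: "{z. f z \<inter> Q k \<noteq> {}} \<in> sets borel" for k
  proof -
    have "{F. closedin T F \<and> F \<inter> Q k \<noteq> {}} \<in> sets (effros_borel T)"
      unfolding effros_borel_def using Q by (subst sets_measure_of) auto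
    from measurable_sets[OF f(1) this] show ?thesis
      using cl by (simp add: vimage_def)
  qed
  obtain D :: "(nat \<Rightarrow> nat) set" and e :: "nat \<Rightarrow> nat" where D: "closed D"
    and code: "\<And>z. \<exists>y\<in>D. \<forall>k. y (e k) \<noteq> 0 \<longleftrightarrow> z \<in> {z. f z \<inter> Q k \<noteq> {}}"
    and decode: "\<And>y. y \<in> D \<Longrightarrow> \<exists>z. \<forall>k. y (e k) \<noteq> 0 \<longleftrightarrow> z \<in> {z. f z \<inter> Q k \<noteq> {}}"
    by (rule borel_sequence_closed_code[OF meas]) (rule that)
  \<comment> \<open>\<open>f (w y)\<close> is the closed set coded by \<open>y\<close>; the digits
    \<open>y (e k)\<close> tell which \<open>Q k\<close> it meets.\<close>
  obtain w where w: "\<And>y k. y \<in> D \<Longrightarrow> y (e k) \<noteq> 0 \<longleftrightarrow> f (w y) \<inter> Q k \<noteq> {}"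
    using decode unfolding mem_Collect_eq by metis
  have hits: "A \<subseteq> f (w y) \<longleftrightarrow> (\<forall>k. A \<inter> Q k \<noteq> {} \<longrightarrow> y (e k) \<noteq> 0)" if "y \<in> D" "A \<subseteq> X" for y A
    using closedin_subset_iff_base[OF cl, of A Q] base that w topX by simp
  have cover: "\<exists>y\<in>D. A \<subseteq> f (w y)" if A: "A \<in> I" for A
  proof -
    obtain z where z: "A \<subseteq> f z" using A I f(2) by blast
    obtain y where "y \<in> D" "\<forall>k. y (e k) \<noteq> 0 \<longleftrightarrow> f z \<inter> Q k \<noteq> {}" using code[of z] by auto
    then show ?thesis using hits[of y A] z A IX by blast
  qed
  let ?lost = "unfolded_lost G \<phi> Q D e"
  have run: "(\<forall>n. \<not> ?lost (map (\<lambda>i. (a i, g i, y i)) [0..<n])) \<longleftrightarrow>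
      legal_run G \<phi> a g \<and> y \<in> D \<and> run_union \<phi> a g \<subseteq> f (w y)" if "\<And>n. a n \<in> I" for a g y
  proof -
    \<comment> \<open>\<open>hits\<close> needs subsets of \<open>X\<close>; legality puts each
      \<open>g m\<close> in the carrier, so the translates stay in \<open>I\<close>.\<close>
    have "\<phi> (g m) ` a m \<subseteq> X" if "legal_run G \<phi> a g" for m
      using that \<open>\<And>n. a n \<in> I\<close> inv IX by (metis PowD legal_run_def subsetD)
    then show ?thesis
      unfolding unfolded_lost_run_iff[OF D] run_union_def UN_subset_iff using hits by blast
  qed
  show ?thesis
  proof (cases "forced I ?lost []")
    case True
    then obtain \<sigma> where \<sigma>I: "\<And>u. \<sigma> u \<in> I"
      and \<sigma>: "\<And>b. \<exists>n. ?lost ([] @ map (\<lambda>i. (\<sigma> (map b [0..<i]), b i)) [0..<n])"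
      using forced_imp_strategy[of I ?lost "[]"] empty by blast
    have "I_wins G \<phi> I"
    proof (rule unfolded_I_strategy_imp_I_wins[OF \<sigma>I _ cover])
      fix g y
      show "\<not> (run_union \<phi> (\<lambda>n. \<sigma> (map (\<lambda>i. (g i, y i)) [0..<n])) g \<subseteq> f (w y) \<and> y \<in> D)"
        if "legal_run G \<phi> (\<lambda>n. \<sigma> (map (\<lambda>i. (g i, y i)) [0..<n])) g"
        using that \<sigma>[of "\<lambda>i. (g i, y i)"] run[OF \<sigma>I, of "\<lambda>n. map (\<lambda>i. (g i, y i)) [0..<n]" g y]
        by auto
    qed
    then show ?thesis by (simp add: DC_game_determined_def)
  next
    case False
    then obtain \<tau> where \<tau>: "\<And>a n. (\<forall>n. a n \<in> I) \<Longrightarrow>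
        \<not> ?lost (map (\<lambda>i. (a i, \<tau> (map a [0..<Suc i]))) [0..<n])"
      using not_forced_imp_strategy by blast
    have "legal_run G \<phi> a (\<lambda>n. fst (\<tau> (map a [0..<Suc n]))) \<and>
      run_union \<phi> a (\<lambda>n. fst (\<tau> (map a [0..<Suc n]))) \<in> I" if a: "\<forall>n. a n \<in> I" for a
    proof -
      \<comment> \<open>The digits of \<open>\<tau>\<close> code a member of the family containing
        the union, which certifies that it is in \<open>I\<close>; then they are dropped.\<close>
      let ?y = "\<lambda>n. snd (\<tau> (map a [0..<Suc n]))"
      have "legal_run G \<phi> a (\<lambda>n. fst (\<tau> (map a [0..<Suc n]))) \<and>
        run_union \<phi> a (\<lambda>n. fst (\<tau> (map a [0..<Suc n]))) \<subseteq> f (w ?y)"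
        using run[of a "\<lambda>n. fst (\<tau> (map a [0..<Suc n]))" ?y] \<tau>[OF a] a
        unfolding prod.collapse by blast
      then show ?thesis using I f(2) by blast
    qed
    then have "II_wins G \<phi> I"
      unfolding II_wins_def by (intro exI[of _ "\<lambda>u. fst (\<tau> u)"]) blast
    then show ?thesis by (simp add: DC_game_determined_def)
  qed
qed

theorem mainTheorem7:
  fixes G :: "('g, 'b) monoid_scheme" and \<phi> :: "'g \<Rightarrow> 'x \<Rightarrow> 'x"
    and X :: "'x set" and I :: "'x set set"
  assumes "dynamical_ideal G \<phi> X I"
  shows "(\<forall>(atom :: 'x \<Rightarrow> 'v) mem act.
            atom_structure G \<phi> X atom mem act \<longrightarrow>
            W_contains_DC_counterexample G \<phi> X I atom mem act \<longrightarrow>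
            I_wins G \<phi> I)
       \<and> (\<forall>T \<F>. Polish_topology T \<longrightarrow> topspace T = X \<longrightarrow>
            \<F> \<subseteq> {F. closedin T F} \<longrightarrow>
            analytic_in (effros_borel T) \<F> \<longrightarrow>
            I = {A. \<exists>B\<in>\<F>. A \<subseteq> B} \<longrightarrow>
            DC_game_determined G \<phi> I)"
  using DC_counterexample_imp_I_wins[OF assms] analytic_closed_generated_determined[OF assms]
  by blast

end
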